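(* The repeated selection mechanism satisfies truthfulness: $u_i((\theta_i,\theta_{-i}'))\ge u_i((\theta_i',\theta_{-i}'))$ for all $i\in V$, all true types $\theta_i=(e_i,v_i)\in\Theta_i$, all reports $\theta_i'=(e_i',v_i')\in\Theta_i$ (with $e_i'\subseteq e_i$, $v_i'\ge 0$), and all $\theta_{-i}'\in\Theta_{-i}$, where both utilities are evaluated with the true valuation $v_i$.
   Context: **Cost sharing problem.** Let $V$ be a finite set of nodes, $s\notin V$ a source, and $G=\langle V\cup\{s\},E\rangle$ a connected undirected graph in which each edge $(i,j)\in E$ has a cost $c_{(i,j)}\ge 0$. Each $i\in V$ has a private valuation $v_i\ge 0$. For $i\in V\cup\{s\}$ let $e_i$ be the set of edges adjacent to $i$, and let $\theta_i=(e_i,v_i)$ be the type of $i$ (the valuation of $s$ is null). Each node makes a report $\theta_i'=(e_i',v_i')$ with $e_i'\subseteq e_i$ and $v_i'\ge 0$; the source does not behave strategically. Let $\theta'=(\theta_i')_{i\in V\cup\{s\}}=(\theta_i',\theta_{-i}')$ be the report profile, where $\theta_{-i}'$ is the profile of all nodes except $i$. $\Theta_i$ is the type space of $i$, $\Theta$ the space of all profiles, $\Theta_{-i}$ the space of profiles of all nodes except $i$. The induced graph is $G(\theta')=\langle V\cup\{s\},E(\theta')\rangle$ with $E(\theta')=\{(i,j)\in E : (i,j)\in e_i'\cap e_j'\}$. **Mechanism.** A cost sharing mechanism $(g,f,x)$ consists of $g:\Theta\to 2^V$ (selected nodes), $f:\Theta\to 2^E$ with $f(\theta')\subseteq E(\theta')$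 (selected edges connecting the selected nodes), and $x:\Theta\to\mathbb{R}^{|V|}$ (cost shares), with $x_i(\theta')=0$ if $i\notin g(\theta')$. The utility of $i\in V$ with true valuation $v_i$ is $u_i(\theta')=v_i-x_i(\theta')$ if $i\in g(\theta')$, and $0$ otherwise. **Cost function.** For $S\subseteq V$, $C(S)$ is the weight of a minimum Steiner tree of $S\cup\{s\}$ in $G(\theta')$ (a minimum-weight tree containing these nodes, possibly using other nodes), with respect to the current edge costs; $C(S)=+\infty$ if no such tree exists. **Repeated selection mechanism (RSM).** Given $\theta'$, initialize $X^0=0$, $N^0=V$, $M^0=\emptyset$, $W^0=\emptyset$, $\mathcal{E}=\emptyset$. In stage $t=1,2,\dots$: minimize $X^t$ over nonempty $S^t\subseteq N^{t-1}$ subject to $X^t\ge X^{t-1}$, $X^t\cdot|S^t|=C(S^t)$, and $v_i'\ge X^t$ for all $i\in S^t$. - If there is a solution, let $S^t$ be a set attaining the minimum (no particular tie-breaking rule is specified) and set $x_i(\theta')=X^t$ for all $i\in S^t$. Let $\mathcal{E}^t$ be the edge set of the minimum Steiner tree of $S^t\cup\{s\}$. Update $W^t=\{i : v_i'<X^t\}$, $N^t=N^{t-1}\setminus(S^t\cup W^t)$, $M^t=M^{t-1}\cup S^t$, $\mathcal{E}=\mathcal{E}\cup\mathcal{E}^t$, and set $c_{(i,j)}=0$ for all $i\ne j$ in $M^t\cup\{s\}$ (meaning that the remaining nodes can use the edge $(i,j)$ without paying cost). - Otherwise set $g(\theta')=M^{t-1}$, $f(\theta')=\mathcal{E}$ and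 stop. Nodes not in $g(\theta')$ have $x_i(\theta')=0$.
   Formalization: Ties among minimizing sets are broken by an arbitrary but fixed strict linear order on node sets, independent of reports (report-dependent tie-breaking can be manipulated); zero-cost links between all pairs in M^t ∪ {s} are usable even if they are not edges of G(θ'). *)

theory Defs
  imports "HOL-Library.Extended_Real" "HOL-Library.FuncSet"
begin

text \<open>An undirected edge \<open>(i, j)\<close> is the set \<open>{i, j}\<close> with \<open>i \<noteq> j\<close>.\<close>

definition pairs :: "'a set \<Rightarrow> 'a set set" where
  "pairs A = {{i, j} | i j. i \<in> A \<and> j \<in> A \<and> i \<noteq> j}"

definition connected_graph :: "'a set \<Rightarrow> 'a set set \<Rightarrow> bool" where
  "connected_graph U F \<longleftrightarrow>
     U \<noteq> {} \<and> F \<subseteq> pairs U \<and> (\<forall>u\<in>U. \<forall>v\<in>U. (u, v) \<in> {(a, b). {a, b} \<in> F}\<^sup>*)"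

definition graph_cycle :: "'a set set \<Rightarrow> 'a list \<Rightarrow> bool" where
  "graph_cycle F p \<longleftrightarrow>
     length p \<ge> 3 \<and> distinct p \<and> (\<forall>k<length p. {p ! k, p ! (Suc k mod length p)} \<in> F)"

definition tree :: "'a set \<Rightarrow> 'a set set \<Rightarrow> bool" where
  "tree U F \<longleftrightarrow> connected_graph U F \<and> (\<nexists>p. graph_cycle F p)"

record 'a problem =
  nodes :: "'a set"
  source :: 'a
  edges :: "'a set set"
  cost :: "'a set \<Rightarrow> real"

definition vertices :: "'a problem \<Rightarrow> 'a set" where
  "vertices P = insert (source P) (nodes P)"

definition cost_sharing_problem :: "'a problem \<Rightarrow> bool" where
  "cost_sharing_problem P \<longleftrightarrow>
     finite (nodes P) \<and> source P \<notin> nodes P \<and>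
     connected_graph (vertices P) (edges P) \<and> (\<forall>e\<in>edges P. cost P e \<ge> 0)"

text \<open>A type (and a report) of a node consists of a set of adjacent edges and a valuation.
  The source is not strategic: it always reports all its edges, and its valuation is null.\<close>

type_synonym 'a node_type = "'a set set \<times> real"

type_synonym 'a profile = "'a \<Rightarrow> 'a node_type"

definition incident :: "'a problem \<Rightarrow> 'a \<Rightarrow> 'a set set" where
  "incident P i = {e \<in> edges P. i \<in> e}"

definition type_space :: "'a problem \<Rightarrow> 'a \<Rightarrow> 'a node_type set" where
  "type_space P i =
     (if i = source P then {(incident P i, 0)} else {(e, v). e \<subseteq> incident P i \<and> 0 \<le> v})"

definition profiles :: "'a problem \<Rightarrow> 'a profile set" where
  "profiles P = Pi\<^sub>E (vertices P) (type_space P)"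

definition induced_edges :: "'a problem \<Rightarrow> 'a profile \<Rightarrow> 'a set set" where
  "induced_edges P \<theta> = {{i, j} | i j. {i, j} \<in> edges P \<and> {i, j} \<in> fst (\<theta> i) \<inter> fst (\<theta> j)}"

definition utility ::
  "('a profile \<Rightarrow> 'a set) \<Rightarrow> ('a profile \<Rightarrow> 'a \<Rightarrow> real) \<Rightarrow> real \<Rightarrow> 'a \<Rightarrow> 'a profile \<Rightarrow> real"
where
  "utility g x v i \<theta> = (if i \<in> g \<theta> then v - x \<theta> i else 0)"

text \<open>After the nodes of \<open>M\<close> have been selected, \<open>c\<^bsub>(i,j)\<^esub>\<close> is \<open>0\<close> for \<^emph>\<open>all\<close> distinct
  \<open>i\<close>, \<open>j\<close> in \<open>M \<union> {s}\<close>: all these nodes are already connected to the source, and the remaining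
  nodes can use every such link for free, whether or not it is an edge of the induced graph.\<close>

definition current_edges :: "'a problem \<Rightarrow> 'a profile \<Rightarrow> 'a set \<Rightarrow> 'a set set" where
  "current_edges P \<theta> M = induced_edges P \<theta> \<union> pairs (insert (source P) M)"

definition current_cost :: "'a problem \<Rightarrow> 'a set \<Rightarrow> 'a set \<Rightarrow> real" where
  "current_cost P M e = (if e \<in> pairs (insert (source P) M) then 0 else cost P e)"

definition steiner_tree ::
  "'a problem \<Rightarrow> 'a profile \<Rightarrow> 'a set \<Rightarrow> 'a set \<Rightarrow> 'a set \<Rightarrow> 'a set set \<Rightarrow> bool"
where
  "steiner_tree P \<theta> M S U F \<longleftrightarrow>
     tree U F \<and> insert (source P) S \<subseteq> U \<and> U \<subseteq> vertices P \<and> F \<subseteq> current_edges P \<theta> M"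

definition weight :: "'a problem \<Rightarrow> 'a set \<Rightarrow> 'a set set \<Rightarrow> ereal" where
  "weight P M F = ereal (\<Sum>e\<in>F. current_cost P M e)"

text \<open>The infimum is over finitely many trees, hence a minimum, unless there is no tree, in which
  case it is \<open>\<infinity>\<close>.\<close>

definition steiner_cost :: "'a problem \<Rightarrow> 'a profile \<Rightarrow> 'a set \<Rightarrow> 'a set \<Rightarrow> ereal" where
  "steiner_cost P \<theta> M S = Inf {weight P M F | U F. steiner_tree P \<theta> M S U F}"

definition min_steiner_tree ::
  "'a problem \<Rightarrow> 'a profile \<Rightarrow> 'a set \<Rightarrow> 'a set \<Rightarrow> 'a set \<Rightarrow> 'a set set \<Rightarrow> bool"
where
  "min_steiner_tree P \<theta> M S U F \<longleftrightarrow>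
     steiner_tree P \<theta> M S U F \<and> weight P M F = steiner_cost P \<theta> M S"

record 'a stage =
  price :: real
  remaining :: "'a set"
  selected :: "'a set"
  bought :: "'a set set"
  share :: "'a \<Rightarrow> real"

definition initial_stage :: "'a problem \<Rightarrow> 'a stage" where
  "initial_stage P =
     \<lparr>price = 0, remaining = nodes P, selected = {}, bought = {}, share = (\<lambda>_. 0)\<rparr>"

definition feasible ::
  "'a problem \<Rightarrow> 'a profile \<Rightarrow> 'a stage \<Rightarrow> 'a set \<Rightarrow> real \<Rightarrow> bool"
where
  "feasible P \<theta> \<sigma> S X \<longleftrightarrow>
     S \<noteq> {} \<and> S \<subseteq> remaining \<sigma> \<and> X \<ge> price \<sigma> \<and>
     ereal (X * real (card S)) = steiner_cost P \<theta> (selected \<sigma>) S \<and>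
     (\<forall>i\<in>S. snd (\<theta> i) \<ge> X)"

definition optimal ::
  "'a problem \<Rightarrow> 'a profile \<Rightarrow> 'a stage \<Rightarrow> 'a set \<Rightarrow> real \<Rightarrow> bool"
where
  "optimal P \<theta> \<sigma> S X \<longleftrightarrow>
     feasible P \<theta> \<sigma> S X \<and> (\<forall>S' X'. feasible P \<theta> \<sigma> S' X' \<longrightarrow> X \<le> X')"

text \<open>Several sets can attain the minimum. Ties are broken by a priority order \<open>R\<close> on the sets of
  nodes, which can be any strict linear order but does not depend on the reports. If the choice
  among tied sets could vary with the reports, a node could gain by a misreport that merely changes
  this choice: tied sets \<open>{a, b}\<close> and \<open>{a, c}\<close> can lead to different prices for \<open>c\<close>.\<close>

definition chosen ::
  "'a problem \<Rightarrow> 'a set rel \<Rightarrow> 'a profile \<Rightarrow> 'a stage \<Rightarrow> 'a set \<Rightarrow> real \<Rightarrow> bool"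
where
  "chosen P R \<theta> \<sigma> S X \<longleftrightarrow>
     optimal P \<theta> \<sigma> S X \<and> (\<forall>S' X'. optimal P \<theta> \<sigma> S' X' \<and> S' \<noteq> S \<longrightarrow> (S, S') \<in> R)"

text \<open>The minimum Steiner tree added in a stage is arbitrary. Only its edges in the induced graph
  are recorded; the other ones are free links between nodes that are already connected.\<close>

inductive rsm_run :: "'a problem \<Rightarrow> 'a set rel \<Rightarrow> 'a profile \<Rightarrow> 'a stage \<Rightarrow> bool"
  for P :: "'a problem" and R :: "'a set rel" and \<theta> :: "'a profile"
where
  init: "rsm_run P R \<theta> (initial_stage P)"
| step: "rsm_run P R \<theta>
           \<lparr>price = X,
            remaining = remaining \<sigma> - (S \<union> {i. snd (\<theta> i) < X}),
            selected = selected \<sigma> \<union> S,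
            bought = bought \<sigma> \<union> (F \<inter> induced_edges P \<theta>),
            share = (\<lambda>i. if i \<in> S then X else share \<sigma> i)\<rparr>"
  if "rsm_run P R \<theta> \<sigma>" and "chosen P R \<theta> \<sigma> S X"
    and "min_steiner_tree P \<theta> (selected \<sigma>) S U F"

definition rsm_outcome ::
  "'a problem \<Rightarrow> 'a set rel \<Rightarrow> 'a profile \<Rightarrow> 'a set \<Rightarrow> 'a set set \<Rightarrow> ('a \<Rightarrow> real) \<Rightarrow> bool"
where
  "rsm_outcome P R \<theta> G T x \<longleftrightarrow>
     (\<exists>\<sigma>. rsm_run P R \<theta> \<sigma> \<and> (\<nexists>S X. feasible P \<theta> \<sigma> S X) \<and>
          G = selected \<sigma> \<and> T = bought \<sigma> \<and> x = share \<sigma>)"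

definition repeated_selection_mechanism ::
  "'a problem \<Rightarrow> 'a set rel \<Rightarrow> ('a profile \<Rightarrow> 'a set) \<Rightarrow> ('a profile \<Rightarrow> 'a set set) \<Rightarrow>
   ('a profile \<Rightarrow> 'a \<Rightarrow> real) \<Rightarrow> bool"
where
  "repeated_selection_mechanism P R g f x \<longleftrightarrow>
     (\<forall>\<theta>\<in>profiles P. rsm_outcome P R \<theta> (g \<theta>) (f \<theta>) (x \<theta>))"

end

theory Submission
  imports Defs
begin

text \<open>The price never decreases, and every nonempty set of remaining nodes has an average Steiner
  cost of at least the current price: a cheaper set \<open>T\<close> could have been added to the set \<open>S\<close> bought
  in the previous stage, because \<open>C\<^sub>M(S \<union> T) \<le> C\<^sub>M(S) + C\<^bsub>M \<union> S\<^esub>(T)\<close>. Hence the constraint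
  \<open>X\<^sup>t \<ge> X\<^bsup>t-1\<^esup>\<close> never binds, and lowering costs can only lower the next price.

  Run the mechanism on the truth and on a lie of \<open>i\<close> in parallel, and assume that the lie makes \<open>i\<close>
  selected at a price of at most its valuation. While \<open>i\<close> is waiting and both runs agree, the
  truthful price \<open>X\<close> is at most the price of the lie. If the truth selects \<open>i\<close> now, we are done. If
  it selects \<open>S\<close> without \<open>i\<close> by a tree through \<open>i\<close>, then \<open>S \<union> {i}\<close> has the same cost, so that
  optimality of \<open>S\<close> forces \<open>X = 0\<close> and \<open>i\<close> is served for free later. If the tree avoids \<open>i\<close>, then
  it is also available under the lie, and the fixed tie-breaking makes both runs choose \<open>S\<close>.\<close>

section \<open>Spanning trees\<close>

abbreviation adjacency :: "'a set set \<Rightarrow> 'a rel" where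
  "adjacency F \<equiv> {(a, b). {a, b} \<in> F}"

lemma sym_adjacency: "sym (adjacency F)"
  by (auto simp: sym_def insert_commute)

lemma adjacency_rtrancl_sym: "(a, b) \<in> (adjacency F)\<^sup>* \<Longrightarrow> (b, a) \<in> (adjacency F)\<^sup>*"
  using symD[OF sym_rtrancl[OF sym_adjacency]] .

text \<open>The rest of the cycle still joins both ends of the deleted edge, so reachability
  survives.\<close>

lemma graph_cycle_redundant_edge:
  assumes "graph_cycle F p"
  obtains e where "e \<in> F" "adjacency F \<subseteq> (adjacency (F - {e}))\<^sup>*"
proof -
  define n where "n = length p"
  have n: "n \<ge> 3" and d: "distinct p" and E: "\<And>k. k < n \<Longrightarrow> {p ! k, p ! (Suc k mod n)} \<in> F"
    using assms by (auto simp: graph_cycle_def n_def)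
  \<comment> \<open>The edge that closes the cycle, at the index where \<open>Suc k mod n\<close>
    wraps around to 0.\<close>
  define e where "e = {p ! (n - 1), p ! 0}"
  have "e \<in> F" using E[of "n - 1"] n by (simp add: e_def)
  have neq: "p ! a \<noteq> p ! b" if "a < n" "b < n" "a \<noteq> b" for a b
    using that d by (simp add: n_def nth_eq_iff_index_eq)
  have path: "k < n \<Longrightarrow> (p ! 0, p ! k) \<in> (adjacency (F - {e}))\<^sup>*" for k
  proof (induction k)
    case (Suc k)
    have "{p ! k, p ! Suc k} \<in> F" using E[of k] Suc.prems by simp
    moreover have "p ! Suc k \<noteq> p ! 0" "k \<noteq> 0 \<Longrightarrow> p ! k \<noteq> p ! 0" "p ! k \<noteq> p ! (n - 1)"
      using neq[of "Suc k" 0] neq[of k 0] neq[of k "n - 1"] Suc.prems by auto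
    \<comment> \<open>The path edge leaving \<open>p ! 0\<close> ends at \<open>p ! 1\<close>, which
      is not the last vertex because \<open>n \<ge> 3\<close>; so it is not
      \<open>e\<close>.\<close>
    moreover have "k = 0 \<Longrightarrow> p ! Suc k \<noteq> p ! (n - 1)"
      using neq[of "Suc k" "n - 1"] Suc.prems n by auto
    ultimately have "{p ! k, p ! Suc k} \<in> F - {e}"
      by (auto simp: e_def doubleton_eq_iff)
    with Suc show ?case by (auto intro: rtrancl_into_rtrancl)
  qed simp
  have "(p ! 0, p ! (n - 1)) \<in> (adjacency (F - {e}))\<^sup>*" using path n by simp
  note closing = this adjacency_rtrancl_sym[OF this]
  have "(a, b) \<in> (adjacency (F - {e}))\<^sup>*" if "{a, b} \<in> F" for a b
  proof (cases "{a, b} = e")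
    case True
    then show ?thesis using closing by (auto simp: e_def doubleton_eq_iff)
  next
    case False
    then show ?thesis using that by auto
  qed
  with \<open>e \<in> F\<close> show ?thesis by (intro that) auto
qed

lemma connected_graph_transfer:
  assumes "connected_graph U F" "F' \<subseteq> pairs U" "adjacency F \<subseteq> (adjacency F')\<^sup>*"
  shows "connected_graph U F'"
proof -
  have "(adjacency F)\<^sup>* \<subseteq> (adjacency F')\<^sup>*"
    using rtrancl_subset_rtrancl assms(3) by blast
  then show ?thesis using assms(1,2) by (simp add: connected_graph_def subset_iff)
qed

text \<open>Redundant cycle edges are deleted one at a time; finiteness of \<open>F\<close> makes
  this stop at an acyclic graph on the same vertices.\<close>

lemma spanning_tree:
  assumes "finite F" "connected_graph U F"
  obtains F' where "F' \<subseteq> F" "tree U F'"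
proof -
  have "\<exists>F'\<subseteq>F. tree U F'"
    using assms
  proof (induction F rule: finite_psubset_induct)
    case (psubset F)
    show ?case
    proof (cases "\<exists>p. graph_cycle F p")
      case True
      then obtain e where e: "e \<in> F" "adjacency F \<subseteq> (adjacency (F - {e}))\<^sup>*"
        using graph_cycle_redundant_edge by blast
      moreover have "F - {e} \<subseteq> pairs U" using psubset.prems by (auto simp: connected_graph_def)
      ultimately have "connected_graph U (F - {e})"
        using connected_graph_transfer psubset.prems by blast
      with psubset.IH[of "F - {e}"] e(1) show ?thesis by blast
    next
      case False
      then show ?thesis using psubset.prems by (auto simp: tree_def)
    qed
  qed
  with that show ?thesis by blast
qed

lemma connected_graphI_root:
  assumes "r \<in> U" "F \<subseteq> pairs U" "\<And>u. u \<in> U \<Longrightarrow> (r, u) \<in> (adjacency F)\<^sup>*"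
  shows "connected_graph U F"
proof -
  have "(u, v) \<in> (adjacency F)\<^sup>*" if "u \<in> U" "v \<in> U" for u v
    by (rule rtrancl_trans[OF adjacency_rtrancl_sym[OF assms(3)[OF that(1)]] assms(3)[OF that(2)]])
  then show ?thesis using assms(1,2) by (auto simp only: connected_graph_def)
qed

lemma pairs_mono: "A \<subseteq> B \<Longrightarrow> pairs A \<subseteq> pairs B"
  by (auto simp: pairs_def)

lemma finite_pairs: "finite A \<Longrightarrow> finite (pairs A)"
  by (rule finite_subset[of _ "Pow A"]) (auto simp: pairs_def)

section \<open>Steiner costs\<close>

locale cost_sharing =
  fixes P :: "'a problem"
  assumes problem: "cost_sharing_problem P"
begin

lemma finite_vertices: "finite (vertices P)"
  using problem by (auto simp: cost_sharing_problem_def vertices_def)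

lemma finite_nodes: "finite (nodes P)"
  using problem by (auto simp: cost_sharing_problem_def)

lemma current_cost_nonneg: "e \<in> current_edges P \<theta> M \<Longrightarrow> 0 \<le> current_cost P M e"
  using problem
  by (auto simp: current_cost_def current_edges_def induced_edges_def cost_sharing_problem_def)

lemma steiner_tree_finite: "steiner_tree P \<theta> M S U F \<Longrightarrow> finite F"
  by (meson connected_graph_def finite_pairs finite_subset finite_vertices steiner_tree_def tree_def)

lemma steiner_cost_le_weight: "steiner_tree P \<theta> M S U F \<Longrightarrow> steiner_cost P \<theta> M S \<le> weight P M F"
  unfolding steiner_cost_def by (rule Inf_lower) blast

text \<open>Passing to a spanning tree only drops edges of nonnegative cost. Upper bounds on Steiner
  costs can thus come from unions of trees, which may contain cycles.\<close>

lemma steiner_cost_le_connected: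
  assumes "connected_graph U F" "insert (source P) S \<subseteq> U" "U \<subseteq> vertices P"
    and F: "F \<subseteq> current_edges P \<theta> M"
  shows "steiner_cost P \<theta> M S \<le> weight P M F"
proof -
  have fin: "finite F"
    using assms finite_vertices by (meson connected_graph_def finite_pairs finite_subset)
  obtain F' where F': "F' \<subseteq> F" "tree U F'" using spanning_tree[OF fin assms(1)] .
  have "steiner_cost P \<theta> M S \<le> weight P M F'"
    using assms F' by (intro steiner_cost_le_weight[where U = U]) (auto simp: steiner_tree_def)
  also have "\<dots> \<le> weight P M F"
    using fin F'(1) F current_cost_nonneg by (auto simp: weight_def intro!: sum_mono2)
  finally show ?thesis .
qed

lemma steiner_cost_nonneg: "0 \<le> steiner_cost P \<theta> M S"
  unfolding steiner_cost_def weight_def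
  by (rule Inf_greatest) (auto simp: steiner_tree_def intro!: sum_nonneg current_cost_nonneg)

lemma steiner_cost_antimono_edges:
  assumes "induced_edges P \<theta>' \<subseteq> induced_edges P \<theta>"
  shows "steiner_cost P \<theta> M S \<le> steiner_cost P \<theta>' M S"
  unfolding steiner_cost_def using assms
  by (intro Inf_superset_mono) (fastforce simp: steiner_tree_def current_edges_def)

lemma steiner_cost_mono:
  assumes "S \<subseteq> S'"
  shows "steiner_cost P \<theta> M S \<le> steiner_cost P \<theta> M S'"
  unfolding steiner_cost_def using assms
  by (intro Inf_superset_mono) (fastforce simp: steiner_tree_def)

text \<open>Each tree available at \<open>M\<close> is still available at \<open>M'\<close>, where
  the additional free links can only turn some of its edge costs into 0.\<close>

lemma steiner_cost_antimono_selected: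
  assumes "M \<subseteq> M'"
  shows "steiner_cost P \<theta> M' S \<le> steiner_cost P \<theta> M S"
proof -
  have "steiner_cost P \<theta> M' S \<le> weight P M F" if T: "steiner_tree P \<theta> M S U F" for U F
  proof -
    have sub: "pairs (insert (source P) M) \<subseteq> pairs (insert (source P) M')"
      using assms by (intro pairs_mono) auto
    then have "steiner_tree P \<theta> M' S U F"
      using T by (auto simp: steiner_tree_def current_edges_def)
    then have "steiner_cost P \<theta> M' S \<le> weight P M' F" by (rule steiner_cost_le_weight)
    also have "\<dots> \<le> weight P M F"
    proof -
      have "current_cost P M' e \<le> current_cost P M e" if "e \<in> F" for e
        using that sub T current_cost_nonneg[of e \<theta> M]
        by (auto simp: current_cost_def steiner_tree_def split: if_splits)
      then show ?thesis by (auto simp: weight_def intro: sum_mono)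
    qed
    finally show ?thesis .
  qed
  then show ?thesis by (subst (2) steiner_cost_def) (auto intro!: Inf_greatest)
qed

lemma steiner_cost_Un_le:
  assumes M: "M \<subseteq> nodes P"
    and T1: "steiner_tree P \<theta> M S U1 F1" and T2: "steiner_tree P \<theta> (M \<union> S) T U2 F2"
  shows "steiner_cost P \<theta> M (S \<union> T) \<le> weight P M F1 + weight P (M \<union> S) F2"
proof -
  define s where "s = source P"
  define Z where "Z = pairs (insert s (M \<union> S))"
  define Q where "Q = pairs (insert s M)"
  \<comment> \<open>Removing \<open>Z\<close> discards links that may be missing or costly before
    \<open>S\<close> is selected. The links in \<open>Q\<close> are free already at \<open>M\<close>
    and reconnect \<open>M\<close>, which is why \<open>M\<close> joins the vertex set.\<close>
  define U where "U = U1 \<union> U2 \<union> M"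
  define F where "F = F1 \<union> (F2 - Z) \<union> Q"
  have c1: "connected_graph U1 F1" and c2: "connected_graph U2 F2"
    and U1: "insert s S \<subseteq> U1" "U1 \<subseteq> vertices P" and U2: "insert s T \<subseteq> U2" "U2 \<subseteq> vertices P"
    and F1: "F1 \<subseteq> current_edges P \<theta> M" and F2: "F2 \<subseteq> current_edges P \<theta> (M \<union> S)"
    using T1 T2 by (auto simp: steiner_tree_def tree_def s_def)
  have fin: "finite F1" "finite F2" using steiner_tree_finite T1 T2 by blast+
  have QZ: "Q \<subseteq> Z" unfolding Q_def Z_def by (intro pairs_mono) auto
  have "finite Q"
    unfolding Q_def using M finite_nodes by (intro finite_pairs) (auto intro: finite_subset)
  have Q: "current_cost P M e = 0" if "e \<in> Q" for e
    using that by (simp add: current_cost_def Q_def s_def)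
  have sub: "(adjacency F')\<^sup>* \<subseteq> (adjacency F)\<^sup>*" if "F' \<subseteq> F" for F'
    using that by (intro rtrancl_mono) auto
  have r1: "(s, u) \<in> (adjacency F)\<^sup>*" if "u \<in> U1" for u
  proof -
    have "(s, u) \<in> (adjacency F1)\<^sup>*" using that c1 U1(1) by (simp add: connected_graph_def)
    then show ?thesis using sub[of F1] by (auto simp only: F_def)
  qed
  have rM: "(s, u) \<in> (adjacency F)\<^sup>*" if "u \<in> M" for u
  proof (cases "u = s")
    case False
    then have "{s, u} \<in> F" using that by (auto simp: F_def Q_def pairs_def)
    then show ?thesis by auto
  qed auto
  have rZ: "(s, u) \<in> (adjacency F)\<^sup>*" if "u \<in> insert s (M \<union> S)" for u
    using that r1 rM U1(1) by auto
  have "(a, b) \<in> (adjacency F)\<^sup>*" if "{a, b} \<in> F2" for a b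
  proof (cases "{a, b} \<in> Z")
    case True
    then have ab: "a \<in> insert s (M \<union> S)" "b \<in> insert s (M \<union> S)"
      by (auto simp: Z_def pairs_def doubleton_eq_iff)
    show ?thesis
      by (rule rtrancl_trans[OF adjacency_rtrancl_sym[OF rZ[OF ab(1)]] rZ[OF ab(2)]])
  next
    case False
    then show ?thesis using that by (auto simp: F_def)
  qed
  then have "(adjacency F2)\<^sup>* \<subseteq> (adjacency F)\<^sup>*"
    by (intro rtrancl_subset_rtrancl) auto
  then have r2: "(s, u) \<in> (adjacency F)\<^sup>*" if "u \<in> U2" for u
    using that c2 U2(1) by (simp add: connected_graph_def subset_iff)
  have "F \<subseteq> pairs U"
  proof -
    have "pairs U1 \<subseteq> pairs U" "pairs U2 \<subseteq> pairs U"
      by (auto simp: U_def intro!: pairs_mono)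
    then have "F1 \<subseteq> pairs U" "F2 \<subseteq> pairs U"
      using c1 c2 unfolding connected_graph_def by (blast intro: subset_trans)+
    moreover have "Q \<subseteq> pairs U"
      unfolding Q_def using U1(1) by (intro pairs_mono) (auto simp: U_def)
    ultimately show ?thesis by (auto simp: F_def)
  qed
  then have "connected_graph U F"
    using U1(1) r1 r2 rM by (intro connected_graphI_root[of s]) (auto simp: U_def)
  moreover have "F \<subseteq> current_edges P \<theta> M"
    using F1 F2 by (auto simp: F_def Q_def Z_def current_edges_def s_def)
  ultimately have "steiner_cost P \<theta> M (S \<union> T) \<le> weight P M F"
    using U1 U2 M by (intro steiner_cost_le_connected[of U]) (auto simp: U_def s_def vertices_def)
  also have "\<dots> \<le> weight P M F1 + weight P (M \<union> S) F2"
  proof -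
    have nn: "0 \<le> current_cost P M e" if "e \<in> F" for e
      using that \<open>F \<subseteq> current_edges P \<theta> M\<close> current_cost_nonneg by blast
    have "sum (current_cost P M) F \<le> sum (current_cost P M) (F1 \<union> (F2 - Z))
        + sum (current_cost P M) Q"
      unfolding F_def using fin \<open>finite Q\<close> nn
      by (subst sum_Un) (auto simp: F_def intro!: sum_nonneg)
    also have "\<dots> = sum (current_cost P M) (F1 \<union> (F2 - Z))"
      by (simp add: sum.neutral Q)
    also have "\<dots> \<le> sum (current_cost P M) F1 + sum (current_cost P M) (F2 - Z)"
      using fin nn by (subst sum_Un) (auto simp: F_def intro!: sum_nonneg)
    \<comment> \<open>Outside \<open>Z\<close>, hence also outside \<open>Q\<close>, both cost
      functions are the original one.\<close>
    also have "sum (current_cost P M) (F2 - Z) = sum (current_cost P (M \<union> S)) (F2 - Z)"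
      using QZ by (intro sum.cong) (auto simp: current_cost_def Z_def Q_def s_def)
    also have "\<dots> \<le> sum (current_cost P (M \<union> S)) F2"
      using fin F2 current_cost_nonneg by (intro sum_mono2) auto
    finally show ?thesis by (simp add: weight_def)
  qed
  finally show ?thesis .
qed

section \<open>Runs of the mechanism\<close>

text \<open>One stage as a relation, so that the part of a run that starts at an arbitrary stage can
  be handled by \<open>rtranclp\<close> induction.\<close>

definition rsm_step :: "'a set rel \<Rightarrow> 'a profile \<Rightarrow> 'a stage \<Rightarrow> 'a stage \<Rightarrow> bool" where
  "rsm_step R \<theta> \<sigma> \<tau> \<longleftrightarrow> (\<exists>S X U F. chosen P R \<theta> \<sigma> S X \<and> min_steiner_tree P \<theta> (selected \<sigma>) S U F \<and>
     \<tau> = \<lparr>price = X,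
          remaining = remaining \<sigma> - (S \<union> {i. snd (\<theta> i) < X}),
          selected = selected \<sigma> \<union> S,
          bought = bought \<sigma> \<union> (F \<inter> induced_edges P \<theta>),
          share = (\<lambda>i. if i \<in> S then X else share \<sigma> i)\<rparr>)"

lemma rsm_stepE:
  assumes "rsm_step R \<theta> \<sigma> \<tau>"
  obtains S X U F where "chosen P R \<theta> \<sigma> S X" "optimal P \<theta> \<sigma> S X" "feasible P \<theta> \<sigma> S X"
    "min_steiner_tree P \<theta> (selected \<sigma>) S U F" "price \<tau> = X"
    "remaining \<tau> = remaining \<sigma> - (S \<union> {i. snd (\<theta> i) < X})" "selected \<tau> = selected \<sigma> \<union> S"
    "\<And>i. share \<tau> i = (if i \<in> S then X else share \<sigma> i)"
proof -
  from assms obtain S X U F where "chosen P R \<theta> \<sigma> S X"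
    "min_steiner_tree P \<theta> (selected \<sigma>) S U F" and \<tau>: "\<tau> = \<lparr>price = X,
      remaining = remaining \<sigma> - (S \<union> {i. snd (\<theta> i) < X}),
      selected = selected \<sigma> \<union> S,
      bought = bought \<sigma> \<union> (F \<inter> induced_edges P \<theta>),
      share = (\<lambda>i. if i \<in> S then X else share \<sigma> i)\<rparr>"
    unfolding rsm_step_def by blast
  then show ?thesis by (intro that[of S X U F]) (simp_all add: chosen_def optimal_def)
qed

lemma rsm_run_steps: "rsm_run P R \<theta> \<sigma> \<Longrightarrow> (rsm_step R \<theta>)\<^sup>*\<^sup>* (initial_stage P) \<sigma>"
proof (induction rule: rsm_run.induct)
  case (step \<sigma> S X U F)
  then show ?case
    by (elim rtranclp.rtrancl_into_rtrancl) (use step.hyps in \<open>auto simp: rsm_step_def\<close>)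
qed simp

section \<open>Invariant of the stages\<close>

text \<open>The last conjunct makes the average cost of any set of waiting nodes an admissible next
  price. The bound on the shares is individual rationality and later makes truthful utility
  nonnegative.\<close>

definition invariant :: "'a profile \<Rightarrow> 'a stage \<Rightarrow> bool" where
  "invariant \<theta> \<sigma> \<longleftrightarrow> 0 \<le> price \<sigma> \<and> remaining \<sigma> \<subseteq> nodes P \<and> selected \<sigma> \<subseteq> nodes P \<and>
     remaining \<sigma> \<inter> selected \<sigma> = {} \<and> (\<forall>i\<in>remaining \<sigma>. price \<sigma> \<le> snd (\<theta> i)) \<and>
     (\<forall>i\<in>selected \<sigma>. share \<sigma> i \<le> snd (\<theta> i)) \<and>
     (\<forall>T\<subseteq>remaining \<sigma>. T \<noteq> {} \<longrightarrow>
        ereal (price \<sigma> * real (card T)) \<le> steiner_cost P \<theta> (selected \<sigma>) T)"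

lemma invariant_initial:
  assumes "\<And>i. i \<in> nodes P \<Longrightarrow> 0 \<le> snd (\<theta> i)"
  shows "invariant \<theta> (initial_stage P)"
  using assms steiner_cost_nonneg
  by (auto simp: invariant_def initial_stage_def zero_ereal_def[symmetric])

text \<open>The price \<open>Y\<close> is the average cost of \<open>S\<close>. The invariant
  supplies \<open>price \<sigma> \<le> Y\<close>, and whoever can afford \<open>X\<close> can afford
  \<open>Y\<close>.\<close>

lemma feasible_le:
  assumes inv: "invariant \<theta> \<sigma>" and S: "S \<noteq> {}" "S \<subseteq> remaining \<sigma>"
    and le: "steiner_cost P \<theta> (selected \<sigma>) S \<le> ereal (X * real (card S))"
    and val: "\<And>i. i \<in> S \<Longrightarrow> X \<le> snd (\<theta> i)"
  obtains Y where "feasible P \<theta> \<sigma> S Y" "Y \<le> X" "ereal (Y * real (card S)) = steiner_cost P \<theta> (selected \<sigma>) S"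
proof -
  have "finite S" using inv S finite_nodes by (auto simp: invariant_def dest: finite_subset)
  then have card: "0 < card S" using S by (simp add: card_gt_0_iff)
  obtain c where c: "steiner_cost P \<theta> (selected \<sigma>) S = ereal c"
    using le steiner_cost_nonneg[of \<theta> "selected \<sigma>" S]
    by (cases "steiner_cost P \<theta> (selected \<sigma>) S") auto
  define Y where "Y = c / real (card S)"
  have eq: "Y * real (card S) = c" using card by (simp add: Y_def)
  have "Y \<le> X" using le card by (simp add: c Y_def pos_divide_le_eq)
  moreover have "ereal (price \<sigma> * real (card S)) \<le> ereal c"
    using inv S by (auto simp: invariant_def c[symmetric])
  then have "price \<sigma> \<le> Y" using card by (simp add: Y_def pos_le_divide_eq)
  ultimately have "feasible P \<theta> \<sigma> S Y" using S val by (force simp: feasible_def c eq)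
  then show ?thesis using \<open>Y \<le> X\<close> that by (simp add: c eq)
qed

lemma feasible_card_pos:
  assumes "invariant \<theta> \<sigma>" "feasible P \<theta>' \<sigma> S X"
  shows "finite S" "0 < card S"
proof -
  show "finite S"
    using assms finite_nodes unfolding invariant_def feasible_def by (meson finite_subset)
  then show "0 < card S" using assms(2) by (simp add: card_gt_0_iff feasible_def)
qed

text \<open>The average-cost bound is the substantial part: if it failed for \<open>T\<close>,
  subadditivity would give \<open>S \<union> T\<close> an average cost below \<open>X\<close>,
  against the minimality of \<open>X\<close>.\<close>

lemma invariant_step:
  assumes inv: "invariant \<theta> \<sigma>" and step: "rsm_step R \<theta> \<sigma> \<tau>"
  shows "invariant \<theta> \<tau>"
proof -
  obtain S X U F where opt: "optimal P \<theta> \<sigma> S X" and feas: "feasible P \<theta> \<sigma> S X"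
    and tree: "min_steiner_tree P \<theta> (selected \<sigma>) S U F"
    and \<tau>: "price \<tau> = X" "remaining \<tau> = remaining \<sigma> - (S \<union> {i. snd (\<theta> i) < X})"
      "selected \<tau> = selected \<sigma> \<union> S" "\<And>i. share \<tau> i = (if i \<in> S then X else share \<sigma> i)"
    using step by (elim rsm_stepE) (rule that; assumption)
  have S: "finite S" "0 < card S" using feasible_card_pos[OF inv feas] by auto
  have wF: "weight P (selected \<sigma>) F = ereal (X * real (card S))"
    using tree feas by (simp add: min_steiner_tree_def feasible_def)
  have cost: "ereal (X * real (card T)) \<le> steiner_cost P \<theta> (selected \<tau>) T"
    if T: "T \<subseteq> remaining \<tau>" "T \<noteq> {}" for T
  proof (rule ccontr)
    assume "\<not> ?thesis"
    \<comment> \<open>A strict upper bound on the infimum is witnessed by an actual tree.\<close>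
    then obtain U2 F2 where T2: "steiner_tree P \<theta> (selected \<tau>) T U2 F2"
      and w2: "weight P (selected \<tau>) F2 < ereal (X * real (card T))"
      by (auto simp: steiner_cost_def[of P \<theta> _ T] Inf_less_iff not_le)
    have finT: "finite T" using T(1) inv finite_nodes
      by (auto simp: invariant_def \<tau> dest: finite_subset)
    have "steiner_cost P \<theta> (selected \<sigma>) (S \<union> T)
        \<le> weight P (selected \<sigma>) F + weight P (selected \<tau>) F2"
      using inv tree T2 unfolding \<tau>(3)
      by (intro steiner_cost_Un_le) (auto simp: invariant_def min_steiner_tree_def)
    also have "\<dots> < ereal (X * real (card S)) + ereal (X * real (card T))"
      using w2 unfolding wF by (intro ereal_less_add) auto
    also have "\<dots> = ereal (X * real (card (S \<union> T)))"
      using T(1) S(1) finT by (subst card_Un_disjoint) (auto simp: \<tau> algebra_simps)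
    finally have less: "steiner_cost P \<theta> (selected \<sigma>) (S \<union> T) < ereal (X * real (card (S \<union> T)))" .
    \<comment> \<open>Nodes with valuation below \<open>X\<close> have left
      \<open>remaining \<tau>\<close>, so all of \<open>T\<close> can afford
      \<open>X\<close>.\<close>
    have ST: "S \<union> T \<noteq> {}" "S \<union> T \<subseteq> remaining \<sigma>" "\<And>i. i \<in> S \<union> T \<Longrightarrow> X \<le> snd (\<theta> i)"
      using feas T by (auto simp: feasible_def \<tau>)
    obtain Y where Y: "feasible P \<theta> \<sigma> (S \<union> T) Y"
        "ereal (Y * real (card (S \<union> T))) = steiner_cost P \<theta> (selected \<sigma>) (S \<union> T)"
      using feasible_le[OF inv ST(1,2) less_imp_le[OF less] ST(3)] by blast
    then have "X \<le> Y" using opt by (simp add: optimal_def)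
    then have "X * real (card (S \<union> T)) \<le> Y * real (card (S \<union> T))" by (intro mult_right_mono) auto
    then show False using less unfolding Y(2)[symmetric] by simp
  qed
  have "0 \<le> price \<sigma>" "remaining \<sigma> \<subseteq> nodes P" "selected \<sigma> \<subseteq> nodes P"
    "remaining \<sigma> \<inter> selected \<sigma> = {}" "\<forall>i\<in>selected \<sigma>. share \<sigma> i \<le> snd (\<theta> i)"
    using inv by (simp_all add: invariant_def)
  moreover have "S \<subseteq> remaining \<sigma>" "price \<sigma> \<le> X" "\<forall>i\<in>S. X \<le> snd (\<theta> i)"
    using feas by (simp_all add: feasible_def)
  ultimately have "0 \<le> X" "remaining \<tau> \<subseteq> nodes P" "selected \<tau> \<subseteq> nodes P"
    "remaining \<tau> \<inter> selected \<tau> = {}" "\<forall>i\<in>remaining \<tau>. X \<le> snd (\<theta> i)"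
    "\<forall>i\<in>selected \<tau>. share \<tau> i \<le> snd (\<theta> i)"
    unfolding \<tau>(2-) by auto
  with cost show ?thesis unfolding invariant_def \<tau>(1) by blast
qed

lemma invariant_steps: "(rsm_step R \<theta>)\<^sup>*\<^sup>* \<sigma> \<tau> \<Longrightarrow> invariant \<theta> \<sigma> \<Longrightarrow> invariant \<theta> \<tau>"
  by (induction rule: rtranclp_induct) (auto intro: invariant_step)

section \<open>Fate of a single node along a run\<close>

text \<open>Stages select only among remaining nodes and never restore a node, so the fate of a node
  is settled once it leaves.\<close>

lemma not_remaining_steps:
  "(rsm_step R \<theta>)\<^sup>*\<^sup>* \<sigma> \<tau> \<Longrightarrow> i \<notin> remaining \<sigma> \<Longrightarrow>
    i \<notin> remaining \<tau> \<and> (i \<in> selected \<tau> \<longleftrightarrow> i \<in> selected \<sigma>) \<and> share \<tau> i = share \<sigma> i"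
proof (induction rule: rtranclp_induct)
  case (step \<tau> \<upsilon>)
  from step.hyps(2) show ?case
    by (rule rsm_stepE) (use step.IH step.prems in \<open>auto simp: feasible_def\<close>)
qed simp

text \<open>A share is the price of the stage that selects the node, and feasibility keeps prices
  from decreasing.\<close>

lemma price_le_share_steps:
  assumes "(rsm_step R \<theta>)\<^sup>*\<^sup>* \<sigma> \<tau>" "i \<notin> selected \<sigma>"
  shows "price \<sigma> \<le> price \<tau> \<and> (i \<in> selected \<tau> \<longrightarrow> price \<sigma> \<le> share \<tau> i)"
  using assms
proof (induction rule: rtranclp_induct)
  case (step \<tau> \<upsilon>)
  from step.hyps(2) show ?case
    by (rule rsm_stepE) (use step.IH step.prems in \<open>auto simp: feasible_def\<close>)
qed simp

text \<open>While \<open>i\<close> waits, \<open>{i}\<close> is feasible at a price of at most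
  \<open>q\<close>, so no stage price exceeds \<open>q\<close>. Hence \<open>i\<close> is not
  discarded, its cost only falls as more nodes are selected, and the run cannot stop before serving
  it.\<close>

lemma selected_if_singleton_affordable:
  assumes "(rsm_step R \<theta>)\<^sup>*\<^sup>* \<sigma> \<tau>" "\<nexists>S X. feasible P \<theta> \<tau> S X"
    and "invariant \<theta> \<sigma>" "i \<in> remaining \<sigma>"
    and "steiner_cost P \<theta> (selected \<sigma>) {i} \<le> ereal q" "q \<le> snd (\<theta> i)"
  shows "i \<in> selected \<tau> \<and> share \<tau> i \<le> q"
  using assms
proof (induction rule: converse_rtranclp_induct)
  case base
  then show ?case using feasible_le[of \<theta> \<tau> "{i}" q] by auto
next
  case (step \<sigma> \<rho>)
  obtain Y where Y: "feasible P \<theta> \<sigma> {i} Y" "Y \<le> q"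
    using step.prems by (auto intro: feasible_le[of \<theta> \<sigma> "{i}" q])
  obtain S X where opt: "optimal P \<theta> \<sigma> S X"
    and \<rho>: "remaining \<rho> = remaining \<sigma> - (S \<union> {i. snd (\<theta> i) < X})"
      "selected \<rho> = selected \<sigma> \<union> S" "\<And>i. share \<rho> i = (if i \<in> S then X else share \<sigma> i)"
    using step.hyps(1) by (elim rsm_stepE) (rule that; assumption)
  have X: "X \<le> q" using opt Y by (force simp: optimal_def)
  show ?case
  proof (cases "i \<in> S")
    case True
    then show ?thesis using not_remaining_steps[OF step.hyps(2), of i] X by (auto simp: \<rho>)
  next
    case False
    have "steiner_cost P \<theta> (selected \<rho>) {i} \<le> ereal q"
      using steiner_cost_antimono_selected[of "selected \<sigma>" "selected \<rho>" \<theta> "{i}"] step.prems(4)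
      by (auto simp: \<rho> intro: order_trans)
    then show ?thesis
      using False X step.prems step.hyps(1) by (intro step.IH) (auto simp: \<rho> intro: invariant_step)
  qed
qed

section \<open>Truth against lie\<close>

text \<open>Exposes the next stage of a run that selects \<open>i\<close> now or later. A node
  passed over now must remain, since a discarded node is never selected.\<close>

lemma selected_laterE:
  assumes steps: "(rsm_step R \<theta>)\<^sup>*\<^sup>* \<sigma> \<tau>" and i: "i \<notin> selected \<sigma>" "i \<in> selected \<tau>"
  obtains S X \<rho> where "chosen P R \<theta> \<sigma> S X" "optimal P \<theta> \<sigma> S X" "feasible P \<theta> \<sigma> S X"
    "price \<rho> = X" "remaining \<rho> = remaining \<sigma> - (S \<union> {i. snd (\<theta> i) < X})"
    "selected \<rho> = selected \<sigma> \<union> S" "(rsm_step R \<theta>)\<^sup>*\<^sup>* \<rho> \<tau>" "X \<le> share \<tau> i"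
    "i \<notin> S \<Longrightarrow> i \<in> remaining \<rho>"
  using steps
proof (cases rule: converse_rtranclpE)
  case base
  then show ?thesis using i by simp
next
  case (step \<rho>)
  from step(1) show ?thesis
  proof (rule rsm_stepE)
    fix S X U F
    assume S: "chosen P R \<theta> \<sigma> S X" "optimal P \<theta> \<sigma> S X" "feasible P \<theta> \<sigma> S X" "price \<rho> = X"
      "remaining \<rho> = remaining \<sigma> - (S \<union> {i. snd (\<theta> i) < X})" "selected \<rho> = selected \<sigma> \<union> S"
      "\<And>i. share \<rho> i = (if i \<in> S then X else share \<sigma> i)"
    have "X \<le> share \<tau> i"
    proof (cases "i \<in> S")
      case True
      then show ?thesis using not_remaining_steps[OF step(2), of i] S by simp
    next
      case False
      then show ?thesis using price_le_share_steps[OF step(2), of i] S i by simp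
    qed
    moreover have "i \<notin> S \<Longrightarrow> i \<in> remaining \<rho>"
      using not_remaining_steps[OF step(2), of i] S(6) i by auto
    ultimately show ?thesis using that S step(2) by blast
  qed
qed

text \<open>Here \<open>\<theta>\<close> is the truth and \<open>\<theta>'\<close> the lie. The
  induction follows the truthful run; the stage \<open>\<sigma>'\<close> of the lie is arbitrary up
  to agreement in price, remaining and selected nodes, since the bought edges may differ.\<close>

lemma truth_dominates:
  assumes R: "trans R" "irrefl R"
    and edges: "induced_edges P \<theta>' \<subseteq> induced_edges P \<theta>"
      "\<And>d. d \<in> induced_edges P \<theta> - induced_edges P \<theta>' \<Longrightarrow> i \<in> d"
    and others: "\<And>j. j \<noteq> i \<Longrightarrow> snd (\<theta>' j) = snd (\<theta> j)"
    and "(rsm_step R \<theta>)\<^sup>*\<^sup>* \<sigma> \<tau>" "\<nexists>S X. feasible P \<theta> \<tau> S X" "invariant \<theta> \<sigma>"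
    and "(rsm_step R \<theta>')\<^sup>*\<^sup>* \<sigma>' \<tau>'"
    and "price \<sigma>' = price \<sigma>" "remaining \<sigma>' = remaining \<sigma>" "selected \<sigma>' = selected \<sigma>"
    and "i \<in> remaining \<sigma>" "i \<in> selected \<tau>'" "share \<tau>' i \<le> snd (\<theta> i)"
  shows "i \<in> selected \<tau> \<and> share \<tau> i \<le> share \<tau>' i"
  using assms(6-)
proof (induction arbitrary: \<sigma>' rule: converse_rtranclp_induct)
  case base
  then have "i \<notin> selected \<sigma>'" by (auto simp: invariant_def)
  \<comment> \<open>The lie must still make a stage to select \<open>i\<close>; its set would be
    feasible under the truth, where the run has stopped.\<close>
  then obtain S X where S: "feasible P \<theta>' \<sigma>' S X" "X \<le> share \<tau>' i"
    using selected_laterE base.prems(3,8) by metis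
  have "steiner_cost P \<theta> (selected \<tau>) S \<le> ereal (X * real (card S))"
    using S(1) base.prems steiner_cost_antimono_edges[OF edges(1), of "selected \<tau>" S]
    by (simp add: feasible_def)
  moreover have "X \<le> snd (\<theta> j)" if "j \<in> S" for j
    using that S base.prems others[of j] by (cases "j = i") (auto simp: feasible_def)
  moreover have "S \<noteq> {}" "S \<subseteq> remaining \<tau>" using S(1) base.prems by (auto simp: feasible_def)
  ultimately obtain Y where "feasible P \<theta> \<tau> S Y"
    using feasible_le[OF base.prems(2), of S X] by blast
  then show ?case using base.prems by blast
next
  case (step \<sigma> \<rho>)
  note inv = step.prems(2) and state = step.prems(4-6) and i = step.prems(7-9)
  obtain S X U F where ch: "chosen P R \<theta> \<sigma> S X" and opt: "optimal P \<theta> \<sigma> S X"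
    and feas: "feasible P \<theta> \<sigma> S X" and tree: "min_steiner_tree P \<theta> (selected \<sigma>) S U F"
    and \<rho>: "price \<rho> = X" "remaining \<rho> = remaining \<sigma> - (S \<union> {i. snd (\<theta> i) < X})"
      "selected \<rho> = selected \<sigma> \<union> S" "\<And>i. share \<rho> i = (if i \<in> S then X else share \<sigma> i)"
    using step.hyps(1) by (elim rsm_stepE) (rule that; assumption)
  have i_sel: "i \<notin> selected \<sigma>'" using i inv state by (auto simp: invariant_def)
  obtain S' X' \<rho>' where ch': "chosen P R \<theta>' \<sigma>' S' X'" and opt': "optimal P \<theta>' \<sigma>' S' X'"
    and feas': "feasible P \<theta>' \<sigma>' S' X'"
    and \<rho>': "price \<rho>' = X'" "remaining \<rho>' = remaining \<sigma>' - (S' \<union> {i. snd (\<theta>' i) < X'})"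
      "selected \<rho>' = selected \<sigma>' \<union> S'" and steps': "(rsm_step R \<theta>')\<^sup>*\<^sup>* \<rho>' \<tau>'"
    and X': "X' \<le> share \<tau>' i" and i_rem': "i \<notin> S' \<Longrightarrow> i \<in> remaining \<rho>'"
    using selected_laterE[OF step.prems(3) i_sel i(2)] by metis
  have cost_le: "steiner_cost P \<theta> (selected \<sigma>) A \<le> steiner_cost P \<theta>' (selected \<sigma>) A" for A
    by (rule steiner_cost_antimono_edges[OF edges(1)])
  \<comment> \<open>The choice of the lie is feasible under the truth: costs are no higher, and
    \<open>i\<close> can truly pay \<open>X'\<close>, which is at most its final share. This yields
    \<open>X \<le> Y \<le> X'\<close>.\<close>
  have "steiner_cost P \<theta> (selected \<sigma>) S' \<le> ereal (X' * real (card S'))"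
    using feas' cost_le[of S'] state by (simp add: feasible_def)
  moreover have "X' \<le> snd (\<theta> j)" if "j \<in> S'" for j
    using that feas' X' i others[of j] by (cases "j = i") (auto simp: feasible_def)
  moreover have "S' \<noteq> {}" "S' \<subseteq> remaining \<sigma>" using feas' state by (auto simp: feasible_def)
  ultimately obtain Y where Y: "feasible P \<theta> \<sigma> S' Y" "Y \<le> X'"
    using feasible_le[OF inv, of S' X'] by blast
  then have XY: "X \<le> Y" using opt by (simp add: optimal_def)
  have inv_\<rho>: "invariant \<theta> \<rho>" using invariant_step[OF inv step.hyps(1)] .
  have i_rem: "i \<in> remaining \<rho>" if "i \<notin> S"
    using that i X' Y XY by (auto simp: \<rho>)
  consider "i \<in> S" | "i \<notin> S" "i \<in> U" | "i \<notin> S" "i \<notin> U" by blast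
  then show ?case
  proof cases
    case 1
    then show ?thesis
      using not_remaining_steps[OF step.hyps(2), of i] X' XY Y by (auto simp: \<rho>)
  next
    case 2
    note S = feasible_card_pos[OF inv feas]
    \<comment> \<open>The tree already passes through \<open>i\<close>, so it also serves
      \<open>insert i S\<close> at the same weight.\<close>
    have st: "steiner_tree P \<theta> (selected \<sigma>) (insert i S) U F"
      using tree 2 by (auto simp: min_steiner_tree_def steiner_tree_def)
    have w: "weight P (selected \<sigma>) F = ereal (X * real (card S))"
      using tree feas by (simp add: min_steiner_tree_def feasible_def)
    have "0 \<le> X" using feas inv by (simp add: feasible_def invariant_def)
    have "X * real (card S) \<le> X * real (card (insert i S))"
      using S 2 \<open>0 \<le> X\<close> by (simp add: mult_left_mono)
    with steiner_cost_le_weight[OF st] w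
    have "steiner_cost P \<theta> (selected \<sigma>) (insert i S) \<le> ereal (X * real (card (insert i S)))"
      by (metis ereal_less_eq(3) order_trans)
    moreover have "insert i S \<subseteq> remaining \<sigma>" "\<And>j. j \<in> insert i S \<Longrightarrow> X \<le> snd (\<theta> j)"
      using feas i X' XY Y by (auto simp: feasible_def)
    ultimately obtain Z where Z: "feasible P \<theta> \<sigma> (insert i S) Z"
      "ereal (Z * real (card (insert i S))) = steiner_cost P \<theta> (selected \<sigma>) (insert i S)"
      using feasible_le[OF inv, of "insert i S" X] by blast
    then have "X \<le> Z" using opt by (simp add: optimal_def)
    \<comment> \<open>One more payer at a price of at least \<open>X\<close> would raise at most
      \<open>X * real (card S)\<close>, which forces \<open>X = 0\<close>.\<close>
    have "Z * (real (card S) + 1) \<le> X * real (card S)"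
      using Z(2) steiner_cost_le_weight[OF st] w S 2
      by (metis card_insert_disjoint ereal_less_eq(3) of_nat_Suc add.commute)
    moreover have "X * (real (card S) + 1) \<le> Z * (real (card S) + 1)"
      using \<open>X \<le> Z\<close> by (intro mult_right_mono) auto
    ultimately have "X = 0" using \<open>0 \<le> X\<close> by (simp add: algebra_simps)
    have "steiner_cost P \<theta> (selected \<rho>) {i} \<le> steiner_cost P \<theta> (selected \<sigma>) (insert i S)"
      using steiner_cost_antimono_selected[of "selected \<sigma>" "selected \<rho>" \<theta> "{i}"]
        steiner_cost_mono[of "{i}" "insert i S" \<theta> "selected \<sigma>"] by (auto simp: \<rho>)
    also have "\<dots> \<le> ereal 0" using steiner_cost_le_weight[OF st] w \<open>X = 0\<close> by simp
    finally have "i \<in> selected \<tau> \<and> share \<tau> i \<le> 0"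
      using selected_if_singleton_affordable[OF step.hyps(2) step.prems(1) inv_\<rho> i_rem[OF 2(1)]]
        i X' Y XY \<open>X = 0\<close> by auto
    then show ?thesis using X' Y XY \<open>X = 0\<close> by auto
  next
    case 3
    \<comment> \<open>Every edge hidden by the lie touches \<open>i\<close>, whereas no edge of this
      tree does.\<close>
    have "F \<subseteq> current_edges P \<theta>' (selected \<sigma>)"
    proof
      fix d assume d: "d \<in> F"
      then have "d \<in> pairs U" "d \<in> current_edges P \<theta> (selected \<sigma>)"
        using tree by (auto simp: min_steiner_tree_def steiner_tree_def tree_def connected_graph_def)
      moreover from this have "i \<notin> d" using 3 by (auto simp: pairs_def)
      ultimately show "d \<in> current_edges P \<theta>' (selected \<sigma>)"
        using edges(2)[of d] by (auto simp: current_edges_def)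
    qed
    then have "steiner_tree P \<theta>' (selected \<sigma>) S U F"
      using tree by (auto simp: min_steiner_tree_def steiner_tree_def)
    then have "steiner_cost P \<theta>' (selected \<sigma>) S \<le> steiner_cost P \<theta> (selected \<sigma>) S"
      using steiner_cost_le_weight tree by (metis min_steiner_tree_def)
    then have "steiner_cost P \<theta>' (selected \<sigma>) S = steiner_cost P \<theta> (selected \<sigma>) S"
      using cost_le[of S] by simp
    moreover have "\<forall>j\<in>S. X \<le> snd (\<theta>' j)"
      using 3 others feas unfolding feasible_def by metis
    ultimately have lie_feas: "feasible P \<theta>' \<sigma>' S X"
      using feas state by (auto simp: feasible_def)
    then have "X' \<le> X" using opt' by (simp add: optimal_def)
    then have eq: "X' = X" "Y = X" using XY Y by auto
    \<comment> \<open>Both sets are optimal under both profiles. If they differed, \<open>R\<close>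
      would rank each before the other, against transitivity and irreflexivity.\<close>
    have "optimal P \<theta> \<sigma> S' X" using opt Y eq by (auto simp: optimal_def)
    moreover have "optimal P \<theta>' \<sigma>' S X" using opt' lie_feas eq by (auto simp: optimal_def)
    ultimately have "S' = S"
      using ch ch' R unfolding chosen_def irrefl_def by (metis transD)
    \<comment> \<open>Valuations differ only at \<open>i\<close>, and \<open>i\<close> remains in
      both runs.\<close>
    have "remaining \<rho>' = remaining \<rho>"
    proof (intro set_eqI)
      fix j
      show "j \<in> remaining \<rho>' \<longleftrightarrow> j \<in> remaining \<rho>"
        using i_rem i_rem' others[of j] 3 state
        by (cases "j = i") (auto simp: \<rho> \<rho>' eq \<open>S' = S\<close>)
    qed
    then show ?thesis
      using step.prems i_rem 3 inv_\<rho> steps' eq \<open>S' = S\<close> state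
      by (intro step.IH[of \<rho>']) (auto simp: \<rho> \<rho>')
  qed
qed

end

section \<open>Induced graphs under a deviation of one node, and truthfulness\<close>

lemma induced_edges_iff:
  "d \<in> induced_edges P \<theta> \<longleftrightarrow>
    (\<exists>a b. d = {a, b} \<and> d \<in> edges P \<and> d \<in> fst (\<theta> a) \<and> d \<in> fst (\<theta> b))"
  unfolding induced_edges_def by blast

lemma induced_edges_mono:
  assumes "\<And>j. fst (\<theta>' j) \<subseteq> fst (\<theta> j)"
  shows "induced_edges P \<theta>' \<subseteq> induced_edges P \<theta>"
  using assms unfolding subset_iff induced_edges_iff by blast

text \<open>An edge is induced according to the reports of its two ends alone, so only a change at
  one of them can remove it.\<close>

lemma induced_edges_diff:
  assumes "\<And>j. j \<noteq> i \<Longrightarrow> fst (\<theta>' j) = fst (\<theta> j)"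
    and "d \<in> induced_edges P \<theta> - induced_edges P \<theta>'"
  shows "i \<in> d"
  using assms unfolding Diff_iff induced_edges_iff by (metis insertCI)

theorem theorem6p2:
  fixes P :: "'a problem" and R :: "'a set rel"
    and g :: "'a profile \<Rightarrow> 'a set" and f :: "'a profile \<Rightarrow> 'a set set"
    and x :: "'a profile \<Rightarrow> 'a \<Rightarrow> real"
  assumes "cost_sharing_problem P"
    and "strict_linear_order_on (Pow (nodes P)) R"
    and "repeated_selection_mechanism P R g f x"
  shows "\<forall>i\<in>nodes P. \<forall>e v e' v'. \<forall>\<theta>\<in>profiles P.
           (e, v) \<in> type_space P i \<and> (e', v') \<in> type_space P i \<and> e' \<subseteq> e \<longrightarrow>
           utility g x v i (\<theta>(i := (e, v))) \<ge> utility g x v i (\<theta>(i := (e', v')))"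
proof (intro ballI allI impI, elim conjE)
  interpret cost_sharing P using assms(1) by unfold_locales
  fix i e v e' v' \<theta>
  assume i: "i \<in> nodes P" and \<theta>: "\<theta> \<in> profiles P" and truth: "(e, v) \<in> type_space P i"
    and lie: "(e', v') \<in> type_space P i" and sub: "e' \<subseteq> e"
  define \<theta>1 where "\<theta>1 = \<theta>(i := (e, v))"
  define \<theta>2 where "\<theta>2 = \<theta>(i := (e', v'))"
  have prof: "\<theta>1 \<in> profiles P" "\<theta>2 \<in> profiles P"
    using \<theta> truth lie i by (auto simp: profiles_def \<theta>1_def \<theta>2_def vertices_def PiE_def
        extensional_def Pi_def)
  then obtain \<tau>1 \<tau>2 where
    \<tau>1: "rsm_run P R \<theta>1 \<tau>1" "\<nexists>S X. feasible P \<theta>1 \<tau>1 S X" "g \<theta>1 = selected \<tau>1" "x \<theta>1 = share \<tau>1"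
    and \<tau>2: "rsm_run P R \<theta>2 \<tau>2" "g \<theta>2 = selected \<tau>2" "x \<theta>2 = share \<tau>2"
    using assms(3) unfolding repeated_selection_mechanism_def rsm_outcome_def by metis
  have "0 \<le> snd (\<theta>1 j)" if "j \<in> nodes P" for j
  proof -
    have "\<theta>1 j \<in> type_space P j" using prof that by (auto simp: profiles_def vertices_def)
    moreover have "j \<noteq> source P" using that assms(1) by (auto simp: cost_sharing_problem_def)
    ultimately show ?thesis by (auto simp: type_space_def)
  qed
  then have inv: "invariant \<theta>1 (initial_stage P)" by (rule invariant_initial)
  then have "invariant \<theta>1 \<tau>1" using invariant_steps rsm_run_steps \<tau>1(1) by blast
  then have "\<forall>j\<in>selected \<tau>1. share \<tau>1 j \<le> snd (\<theta>1 j)" by (simp add: invariant_def)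
  moreover have "snd (\<theta>1 i) = v" by (simp add: \<theta>1_def)
  ultimately have nonneg: "0 \<le> utility g x v i \<theta>1" by (auto simp: utility_def \<tau>1)
  \<comment> \<open>A lie that leaves \<open>i\<close> unselected or charges it more than
    \<open>v\<close> gives utility at most 0, which truth guarantees; only the other case needs the
    comparison of runs.\<close>
  have "utility g x v i \<theta>2 \<le> utility g x v i \<theta>1"
  proof (cases "i \<in> selected \<tau>2 \<and> share \<tau>2 i \<le> v")
    case True
    have "trans R" "irrefl R" using assms(2) by (auto simp: strict_linear_order_on_def)
    moreover have "induced_edges P \<theta>2 \<subseteq> induced_edges P \<theta>1"
      using sub by (intro induced_edges_mono) (simp add: \<theta>1_def \<theta>2_def)
    moreover have "i \<in> d" if "d \<in> induced_edges P \<theta>1 - induced_edges P \<theta>2" for d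
      using that by (rule induced_edges_diff[rotated]) (simp add: \<theta>1_def \<theta>2_def)
    moreover have "snd (\<theta>2 j) = snd (\<theta>1 j)" if "j \<noteq> i" for j
      using that by (simp add: \<theta>1_def \<theta>2_def)
    moreover have "i \<in> remaining (initial_stage P)" using i by (simp add: initial_stage_def)
    moreover have "share \<tau>2 i \<le> snd (\<theta>1 i)" using True by (simp add: \<theta>1_def)
    ultimately have "i \<in> selected \<tau>1 \<and> share \<tau>1 i \<le> share \<tau>2 i"
      using True inv by (intro truth_dominates[OF _ _ _ _ _ rsm_run_steps[OF \<tau>1(1)] \<tau>1(2) inv
        rsm_run_steps[OF \<tau>2(1)] refl refl refl]) auto
    with True show ?thesis by (simp add: utility_def \<tau>1 \<tau>2)
  next
    case False
    then have "utility g x v i \<theta>2 \<le> 0" by (auto simp: utility_def \<tau>2)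
    with nonneg show ?thesis by simp
  qed
  then show "utility g x v i (\<theta>(i := (e, v))) \<ge> utility g x v i (\<theta>(i := (e', v')))"
    by (simp add: \<theta>1_def \<theta>2_def)
qed

end
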